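(* Let $\sigma$ be an endomorphism of a semiprime ring $R$ which has a large image. Suppose that $R$ has left Krull dimension (for example, $R$ is left noetherian). Then $\ker\sigma$ is not essential as a left ideal of $R$. In particular, if additionally $R$ is a prime ring, then $\sigma$ is an injective endomorphism.
   Context: Rings are associative with unity, not necessarily commutative. For a subset $S\subseteq R$, $\mathrm{rann}_R(S)=\{a\in R\mid Sa=0\}$ is the right annihilator of $S$ in $R$. An endomorphism $\sigma$ of a ring $R$ has a large image if $\sigma(R)$ contains an essential left ideal $L$ of $R$ with $\mathrm{rann}_R(L)=0$. "$R$ has left Krull dimension" means that the left module ${}_RR$ has Krull dimension in the sense of Gabriel–Rentschler (defined via the deviation of the poset of submodules). *)

theory Defs
  imports Main
begin

definition left_ideal :: "'a::ring_1 set \<Rightarrow> bool" where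
  "left_ideal L \<longleftrightarrow>
     0 \<in> L \<and> (\<forall>x\<in>L. \<forall>y\<in>L. x + y \<in> L) \<and> (\<forall>r. \<forall>x\<in>L. r * x \<in> L)"

definition two_sided_ideal :: "'a::ring_1 set \<Rightarrow> bool" where
  "two_sided_ideal I \<longleftrightarrow> left_ideal I \<and> (\<forall>r. \<forall>x\<in>I. x * r \<in> I)"

definition essential_left_ideal :: "'a::ring_1 set \<Rightarrow> bool" where
  "essential_left_ideal L \<longleftrightarrow>
     left_ideal L \<and> (\<forall>K. left_ideal K \<and> K \<noteq> {0} \<longrightarrow> L \<inter> K \<noteq> {0})"

definition rann :: "'a::ring_1 set \<Rightarrow> 'a set" where
  "rann S = {a. \<forall>s\<in>S. s * a = 0}"

(* The product ideal AB vanishes iff all products a * b do.  Class ring_1 contains 0 \<noteq> 1,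
   so prime and semiprime rings are nonzero here. *)
definition semiprime_ring :: "'a::ring_1 itself \<Rightarrow> bool" where
  "semiprime_ring _ \<longleftrightarrow>
     (\<forall>A::'a set. two_sided_ideal A \<and> (\<forall>a\<in>A. \<forall>b\<in>A. a * b = 0) \<longrightarrow> A = {0})"

definition prime_ring :: "'a::ring_1 itself \<Rightarrow> bool" where
  "prime_ring _ \<longleftrightarrow>
     (\<forall>A B::'a set. two_sided_ideal A \<and> two_sided_ideal B \<and> (\<forall>a\<in>A. \<forall>b\<in>B. a * b = 0)
        \<longrightarrow> A = {0} \<or> B = {0})"

definition ring_endomorphism :: "('a::ring_1 \<Rightarrow> 'a) \<Rightarrow> bool" where
  "ring_endomorphism \<sigma> \<longleftrightarrow>
     \<sigma> 1 = 1 \<and> (\<forall>x y. \<sigma> (x + y) = \<sigma> x + \<sigma> y) \<and> (\<forall>x y. \<sigma> (x * y) = \<sigma> x * \<sigma> y)"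

definition ring_kernel :: "('a::ring_1 \<Rightarrow> 'a) \<Rightarrow> 'a set" where
  "ring_kernel \<sigma> = {x. \<sigma> x = 0}"

definition large_image :: "('a::ring_1 \<Rightarrow> 'a) \<Rightarrow> bool" where
  "large_image \<sigma> \<longleftrightarrow> (\<exists>L. essential_left_ideal L \<and> L \<subseteq> range \<sigma> \<and> rann L = {0})"

definition trivial_poset :: "'p::order set \<Rightarrow> bool" where
  "trivial_poset A \<longleftrightarrow> (\<forall>x\<in>A. \<forall>y\<in>A. x \<le> y \<longrightarrow> x = y)"

lemma wf_underS:
  "wf ({((r, \<beta>, B), (r', \<alpha>, A)). r = r' \<and> Well_order r \<and> \<beta> \<in> underS r \<alpha>}
       :: ('o rel \<times> 'o \<times> 'p set) rel)" (is "wf ?R")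
proof (rule wfUNIVI)
  fix P :: "'o rel \<times> 'o \<times> 'p set \<Rightarrow> bool" and z :: "'o rel \<times> 'o \<times> 'p set"
  assume step: "\<forall>x. (\<forall>y. (y, x) \<in> ?R \<longrightarrow> P y) \<longrightarrow> P x"
  obtain r \<alpha> A where z: "z = (r, \<alpha>, A)" by (cases z)
  show "P z"
  proof (cases "Well_order r")
    case True
    then have "wf (r - Id)" by (simp add: well_order_on_def)
    then have "\<forall>A. P (r, \<alpha>, A)"
    proof (induction \<alpha>)
      case (less \<alpha>)
      show ?case
      proof
        fix A show "P (r, \<alpha>, A)"
        proof (rule step[rule_format])
          fix y assume "(y, (r, \<alpha>, A)) \<in> ?R"
          then obtain \<beta> B where "y = (r, \<beta>, B)" "(\<beta>, \<alpha>) \<in> r - Id"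
            by (auto simp: underS_def)
          then show "P y" using less by blast
        qed
      qed
    qed
    then show ?thesis by (simp add: z)
  next
    case False
    then show ?thesis by (intro mp[OF spec[OF step]]) (auto simp: z)
  qed
qed

context
  notes conj_cong [fundef_cong]
begin

(* deviation_eq r \<alpha> A says dev A = \<alpha>, where the ordinal \<alpha> is given as an element of a
   well-order r: A is not trivial (trivial posets have deviation -\<infinity>), dev A is no smaller
   ordinal, and in every descending chain in A all but finitely many of the factors
   {x \<in> A. a (i+1) \<le> x \<le> a i} have deviation less than \<alpha>. *)
function deviation_eq :: "'o rel \<Rightarrow> 'o \<Rightarrow> 'p::order set \<Rightarrow> bool" where
  "deviation_eq r \<alpha> A \<longleftrightarrow>
     Well_order r \<and> \<alpha> \<in> Field r \<and> \<not> trivial_poset A \<and>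
     (\<forall>\<beta>\<in>underS r \<alpha>. \<not> deviation_eq r \<beta> A) \<and>
     (\<forall>a::nat \<Rightarrow> 'p. range a \<subseteq> A \<and> antimono a \<longrightarrow>
        finite {i. \<not> (trivial_poset (A \<inter> {a (Suc i)..a i}) \<or>
                      (\<exists>\<beta>\<in>underS r \<alpha>. deviation_eq r \<beta> (A \<inter> {a (Suc i)..a i})))})"
  by pat_completeness auto
termination
  by (relation "{((r, \<beta>, B), (r', \<alpha>, A)). r = r' \<and> Well_order r \<and> \<beta> \<in> underS r \<alpha>}")
    (rule wf_underS, auto)

end

declare deviation_eq.simps [simp del]

(* Well-orders on the type of pairs provide enough ordinals: if dev A = \<alpha>, every ordinal \<beta> < \<alpha>
   is the deviation of some nontrivial interval of A, so the ordinals up to and including \<alpha>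
   inject into pairs (the diagonal accommodates \<alpha> itself). *)
definition has_deviation :: "'p::order set \<Rightarrow> bool" where
  "has_deviation A \<longleftrightarrow>
     trivial_poset A \<or> (\<exists>r :: ('p \<times> 'p) rel. \<exists>\<alpha>. deviation_eq r \<alpha> A)"

(* The submodules of the left regular module are the left ideals, ordered by inclusion. *)
definition has_left_Krull_dimension :: "'a::ring_1 itself \<Rightarrow> bool" where
  "has_left_Krull_dimension _ \<longleftrightarrow> has_deviation {L::'a set. left_ideal L}"

end

theory Submission
  imports Defs "HOL-Library.Nat_Bijection"
begin

text \<open>
  Write \<open>K\<close> for the kernel of \<open>\<sigma>\<close>, \<open>L \<subseteq> \<sigma>(R)\<close> for the large left ideal, and suppose that \<open>K\<close> is
  essential.  An essential left ideal of a semiprime ring with left Krull dimension contains an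
  element whose left annihilator is zero
  (\<open>essential_contains_left_cancellable\<close>); choose such elements \<open>c \<in> K\<close> and \<open>d \<in> L\<close>.  The map
  \<open>A \<mapsto> \<sigma>\<inverse>(A d)\<close> is then an order embedding of the lattice of all left ideals into its interval
  \<open>[K, R] \<subseteq> [R c, R]\<close>: it reflects inclusions because \<open>A d \<subseteq> L \<subseteq> \<sigma>(R)\<close> and because \<open>d\<close> can be
  cancelled.  Right multiplication by \<open>c\<^sup>n\<close> carries \<open>[R c, R]\<close> to \<open>[R c\<^sup>n\<^sup>+\<^sup>1, R c\<^sup>n]\<close>.  Hence every
  factor of the descending chain \<open>R \<supseteq> R c \<supseteq> R c\<^sup>2 \<supseteq> \<dots>\<close> contains a copy of the whole lattice, and a
  poset with this self-similarity cannot have a deviation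
  (\<open>self_similar_not_embedded_in_deviation\<close>): almost all factors would need a smaller deviation than
  the whole, and the deviation cannot decrease for ever.

  The element \<open>c\<close> comes from Goldie's construction.  Among the nonzero left ideals inside a given
  one, some left ideal \<open>C\<close> is critical: it has minimal deviation \<open>\<alpha>\<close>, and all its proper quotients
  have deviation less than \<open>\<alpha>\<close>.  Since \<open>C\<^sup>2 \<noteq> 0\<close>, some \<open>a \<in> C\<close> has \<open>C a \<noteq> 0\<close>, and right
  multiplication by \<open>a\<close> is injective on \<open>C\<close>, as otherwise \<open>C a \<subseteq> C\<close> would be a nonzero left ideal of
  deviation less than \<open>\<alpha>\<close>.  So every nonzero left ideal contains a nonzero element that
  can be cancelled on the right of its own left multiples.  Choosing such elements
  \<open>a\<^sub>0, a\<^sub>1, \<dots>\<close> in the essential left ideal, each one annihilating the earlier ones from the left,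
  gives a direct sum of left ideals \<open>R a\<^sub>i\<close>.  The choice has to stop, because an infinite direct sum
  would embed the self-similar poset of all subsets of the natural numbers.  When it stops, the
  sum of the \<open>a\<^sub>i\<close> has zero left annihilator.
\<close>

section \<open>Deviation and order embeddings\<close>

definition order_embedding :: "('p::order \<Rightarrow> 'q::order) \<Rightarrow> 'p set \<Rightarrow> 'q set \<Rightarrow> bool" where
  "order_embedding f X Y \<longleftrightarrow> f ` X \<subseteq> Y \<and> (\<forall>x\<in>X. \<forall>y\<in>X. f x \<le> f y \<longleftrightarrow> x \<le> y)"

lemma order_embeddingI:
  assumes "\<And>x. x \<in> X \<Longrightarrow> f x \<in> Y"
    and "\<And>x y. x \<in> X \<Longrightarrow> y \<in> X \<Longrightarrow> x \<le> y \<Longrightarrow> f x \<le> f y"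
    and "\<And>x y. x \<in> X \<Longrightarrow> y \<in> X \<Longrightarrow> f x \<le> f y \<Longrightarrow> x \<le> y"
  shows "order_embedding f X Y"
  using assms unfolding order_embedding_def by blast

lemma order_embedding_mem: "order_embedding f X Y \<Longrightarrow> x \<in> X \<Longrightarrow> f x \<in> Y"
  by (auto simp: order_embedding_def)

lemma order_embedding_le_iff:
  "order_embedding f X Y \<Longrightarrow> x \<in> X \<Longrightarrow> y \<in> X \<Longrightarrow> f x \<le> f y \<longleftrightarrow> x \<le> y"
  by (auto simp: order_embedding_def)

lemma order_embedding_comp:
  "order_embedding f X Y \<Longrightarrow> order_embedding g Y Z \<Longrightarrow> order_embedding (g \<circ> f) X Z"
  by (auto simp: order_embedding_def image_subset_iff)

lemma order_embedding_subset: "X \<subseteq> Y \<Longrightarrow> order_embedding (\<lambda>x. x) X Y"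
  by (auto simp: order_embedding_def)

lemma order_embedding_factor:
  assumes "order_embedding f X Y" "range a \<subseteq> X"
  shows "order_embedding f (X \<inter> {a (Suc i)..a i}) (Y \<inter> {(f \<circ> a) (Suc i)..(f \<circ> a) i})"
proof -
  have "a i \<in> X" "a (Suc i) \<in> X"
    using assms(2) by auto
  then show ?thesis
    using assms(1) by (auto simp: order_embedding_def)
qed

lemma order_embedding_chain:
  assumes "order_embedding f X Y" "range a \<subseteq> X" "antimono a"
  shows "range (f \<circ> a) \<subseteq> Y" and "antimono (f \<circ> a)"
proof -
  have a: "a i \<in> X" for i
    using assms(2) by auto
  show "range (f \<circ> a) \<subseteq> Y"
    using order_embedding_mem[OF assms(1) a] by auto
  show "antimono (f \<circ> a)"
    using assms(3) order_embedding_le_iff[OF assms(1) a a]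
    by (auto simp: antimono_def)
qed

lemma trivial_poset_embedding:
  assumes "order_embedding f X Y" "trivial_poset Y"
  shows "trivial_poset X"
  unfolding trivial_poset_def
proof (intro ballI impI)
  fix x y assume *: "x \<in> X" "y \<in> X" "x \<le> y"
  then have "f x = f y"
    using assms unfolding trivial_poset_def
    by (meson order_embedding_le_iff order_embedding_mem)
  then show "x = y"
    using * order_embedding_le_iff[OF assms(1)] by (metis order_antisym order_refl)
qed

definition deviation_less :: "'o rel \<Rightarrow> 'o \<Rightarrow> 'p::order set \<Rightarrow> bool" where
  "deviation_less r \<alpha> X \<longleftrightarrow> trivial_poset X \<or> (\<exists>\<beta>\<in>underS r \<alpha>. deviation_eq r \<beta> X)"

lemma deviation_eqD:
  assumes "deviation_eq r \<alpha> X"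
  shows "Well_order r" and "\<alpha> \<in> Field r" and "\<not> trivial_poset X"
    and "\<not> deviation_less r \<alpha> X"
    and "range a \<subseteq> X \<Longrightarrow> antimono a \<Longrightarrow>
      finite {i. \<not> deviation_less r \<alpha> (X \<inter> {a (Suc i)..a i})}"
  using assms deviation_eq.simps[of r \<alpha> X] unfolding deviation_less_def by blast+

lemma deviation_eqI:
  assumes "Well_order r" "\<alpha> \<in> Field r" "\<not> deviation_less r \<alpha> X"
    and "\<And>a. range a \<subseteq> X \<Longrightarrow> antimono a \<Longrightarrow>
      finite {i. \<not> deviation_less r \<alpha> (X \<inter> {a (Suc i)..a i})}"
  shows "deviation_eq r \<alpha> X"
  using assms deviation_eq.simps[of r \<alpha> X] unfolding deviation_less_def by blast

lemma well_order_wf: "Well_order r \<Longrightarrow> wf (r - Id)"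
  by (simp add: well_order_on_def)

lemma well_order_underS_trans:
  assumes "Well_order r" "\<gamma> \<in> underS r \<beta>" "\<beta> \<in> underS r \<alpha>"
  shows "\<gamma> \<in> underS r \<alpha>"
proof -
  have "trans r" "antisym r"
    using assms(1) by (auto simp: order_on_defs)
  then show ?thesis
    using assms(2,3) unfolding underS_def by (auto dest: transD antisymD)
qed

lemma deviation_less_trans:
  assumes "Well_order r" "\<beta> \<in> underS r \<alpha>" "deviation_less r \<beta> X"
  shows "deviation_less r \<alpha> X"
  using assms well_order_underS_trans[OF assms(1)] unfolding deviation_less_def by blast

text \<open>
  Deviation is monotone: a chain in the smaller poset is a chain in the larger one, so its factors
  are controlled by induction on \<open>\<alpha>\<close>.
\<close>

lemma deviation_embedding_aux:
  assumes "deviation_eq r \<alpha> Y" "order_embedding f X Y"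
  shows "deviation_less r \<alpha> X \<or> deviation_eq r \<alpha> X"
proof -
  have "Well_order r"
    using assms(1) by (rule deviation_eqD)
  from well_order_wf[OF this] assms show ?thesis
  proof (induction \<alpha> arbitrary: X Y)
    case (less \<alpha>)
    show ?case
    proof (cases "deviation_less r \<alpha> X")
      case True
      then show ?thesis ..
    next
      case not_less: False
      have "deviation_eq r \<alpha> X"
      proof (rule deviation_eqI[OF deviation_eqD(1,2)[OF less.prems(1)] not_less])
        fix a :: "nat \<Rightarrow> _" assume a: "range a \<subseteq> X" "antimono a"
        have factor: "deviation_less r \<alpha> (X \<inter> {a (Suc i)..a i})"
          if "deviation_less r \<alpha> (Y \<inter> {(f \<circ> a) (Suc i)..(f \<circ> a) i})" for i
        proof -
          have emb: "order_embedding f (X \<inter> {a (Suc i)..a i})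
              (Y \<inter> {(f \<circ> a) (Suc i)..(f \<circ> a) i})"
            using order_embedding_factor[OF less.prems(2) a(1)] .
          from that consider "trivial_poset (Y \<inter> {(f \<circ> a) (Suc i)..(f \<circ> a) i})"
            | \<beta> where "\<beta> \<in> underS r \<alpha>" "deviation_eq r \<beta> (Y \<inter> {(f \<circ> a) (Suc i)..(f \<circ> a) i})"
            unfolding deviation_less_def by blast
          then show ?thesis
          proof cases
            case 1
            then show ?thesis
              using trivial_poset_embedding[OF emb] by (simp add: deviation_less_def)
          next
            case 2
            have "(\<beta>, \<alpha>) \<in> r - Id"
              using 2(1) by (auto simp: underS_def)
            from less.IH[OF this 2(2) emb] show ?thesis
              using deviation_less_trans[OF deviation_eqD(1)[OF 2(2)] 2(1)] 2(1)
              unfolding deviation_less_def by blast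
          qed
        qed
        have "finite {i. \<not> deviation_less r \<alpha> (Y \<inter> {(f \<circ> a) (Suc i)..(f \<circ> a) i})}"
          using order_embedding_chain[OF less.prems(2) a] by (rule deviation_eqD(5)[OF less.prems(1)])
        then show "finite {i. \<not> deviation_less r \<alpha> (X \<inter> {a (Suc i)..a i})}"
          by (rule rev_finite_subset) (use factor in blast)
      qed
      then show ?thesis ..
    qed
  qed
qed

lemma deviation_less_embedding:
  assumes "deviation_less r \<alpha> Y" "order_embedding f X Y"
  shows "deviation_less r \<alpha> X"
proof -
  from assms(1) consider "trivial_poset Y"
    | \<beta> where "\<beta> \<in> underS r \<alpha>" "deviation_eq r \<beta> Y"
    unfolding deviation_less_def by blast
  then show ?thesis
  proof cases
    case 1
    then show ?thesis
      using trivial_poset_embedding[OF assms(2)] by (simp add: deviation_less_def)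
  next
    case 2
    then show ?thesis
      using deviation_embedding_aux[OF 2(2) assms(2)]
        deviation_less_trans[OF deviation_eqD(1)[OF 2(2)] 2(1)]
      unfolding deviation_less_def by blast
  qed
qed

lemma deviation_eq_embedding:
  assumes "deviation_eq r \<alpha> Y" "order_embedding f X Y" "\<not> trivial_poset X"
  shows "\<exists>\<beta>. deviation_eq r \<beta> X"
  using deviation_embedding_aux[OF assms(1,2)] assms(3) unfolding deviation_less_def by blast

text \<open>
  The obstruction to a deviation.  If \<open>P\<close> embeds in \<open>A\<close>, then the image of the chain \<open>b\<close> is a chain in
  \<open>A\<close> all of whose factors contain \<open>P\<close> again; one of them must have a smaller deviation, and well-foundedness
  of the ordinals ends the descent.
\<close>

lemma self_similar_not_embedded_in_deviation:
  assumes chain: "range b \<subseteq> P" "antimono b"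
    and self: "\<And>i. order_embedding (g i) P (P \<inter> {b (Suc i)..b i})"
    and nontriv: "\<not> trivial_poset P"
    and dev: "deviation_eq r \<alpha> A"
  shows "\<not> order_embedding f P A"
proof -
  from well_order_wf[OF deviation_eqD(1)[OF dev]] dev show ?thesis
  proof (induction \<alpha> arbitrary: A f)
    case (less \<alpha>)
    show ?case
    proof
      assume f: "order_embedding f P A"
      have "\<not> deviation_less r \<alpha> (A \<inter> {(f \<circ> b) (Suc i)..(f \<circ> b) i})" for i
      proof
        have "order_embedding f (P \<inter> {b (Suc i)..b i}) (A \<inter> {(f \<circ> b) (Suc i)..(f \<circ> b) i})"
          using order_embedding_factor[OF f chain(1)] .
        from order_embedding_comp[OF self this]
        have emb: "order_embedding (f \<circ> g i) P (A \<inter> {(f \<circ> b) (Suc i)..(f \<circ> b) i})" .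
        assume "deviation_less r \<alpha> (A \<inter> {(f \<circ> b) (Suc i)..(f \<circ> b) i})"
        with nontriv trivial_poset_embedding[OF emb] obtain \<beta>
          where \<beta>: "\<beta> \<in> underS r \<alpha>" "deviation_eq r \<beta> (A \<inter> {(f \<circ> b) (Suc i)..(f \<circ> b) i})"
          unfolding deviation_less_def by blast
        then have "(\<beta>, \<alpha>) \<in> r - Id"
          by (auto simp: underS_def)
        from less.IH[OF this \<beta>(2)] emb show False by blast
      qed
      moreover have "finite {i. \<not> deviation_less r \<alpha> (A \<inter> {(f \<circ> b) (Suc i)..(f \<circ> b) i})}"
        using order_embedding_chain[OF f chain] by (rule deviation_eqD(5)[OF less.prems])
      ultimately show False by simp
    qed
  qed
qed

text \<open>
  Identify the natural numbers with pairs of natural numbers.  The sets of pairs whose first component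
  is at least \<open>n\<close> decrease with \<open>n\<close>, and removing one of the infinitely many columns leaves
  room for a copy of the whole power set.
\<close>

lemma power_set_nat_not_embedded_in_deviation:
  assumes "deviation_eq r \<alpha> A"
  shows "\<not> order_embedding (f :: nat set \<Rightarrow> _) UNIV A"
proof (rule self_similar_not_embedded_in_deviation[OF _ _ _ _ assms])
  define b :: "nat \<Rightarrow> nat set" where "b n = {k. n \<le> fst (prod_decode k)}" for n
  show "range b \<subseteq> UNIV" by simp
  show "antimono b" by (auto simp: antimono_def b_def)
  show "order_embedding (\<lambda>S. b (Suc i) \<union> (\<lambda>j. prod_encode (i, j)) ` S) UNIV
      (UNIV \<inter> {b (Suc i)..b i})" for i
  proof (rule order_embeddingI)
    fix S T :: "nat set"
    assume *: "b (Suc i) \<union> (\<lambda>j. prod_encode (i, j)) ` S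
      \<subseteq> b (Suc i) \<union> (\<lambda>j. prod_encode (i, j)) ` T"
    show "S \<subseteq> T"
    proof
      fix j assume "j \<in> S"
      with * have "prod_encode (i, j) \<in> b (Suc i) \<union> (\<lambda>j. prod_encode (i, j)) ` T" by blast
      then show "j \<in> T" by (auto simp: b_def)
    qed
  qed (auto simp: b_def)
  have "{} \<noteq> (UNIV :: nat set)" by simp
  then show "\<not> trivial_poset (UNIV :: nat set set)"
    unfolding trivial_poset_def by blast
qed

section \<open>Left ideals\<close>

lemma left_ideal_zero: "left_ideal A \<Longrightarrow> 0 \<in> A"
  by (simp add: left_ideal_def)

lemma left_ideal_add: "left_ideal A \<Longrightarrow> x \<in> A \<Longrightarrow> y \<in> A \<Longrightarrow> x + y \<in> A"
  by (simp add: left_ideal_def)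

lemma left_ideal_mult: "left_ideal A \<Longrightarrow> x \<in> A \<Longrightarrow> r * x \<in> A"
  by (simp add: left_ideal_def)

lemma left_idealI:
  assumes "0 \<in> A" "\<And>x y. x \<in> A \<Longrightarrow> y \<in> A \<Longrightarrow> x + y \<in> A" "\<And>r x. x \<in> A \<Longrightarrow> r * x \<in> A"
  shows "left_ideal A"
  using assms by (simp add: left_ideal_def)

lemma left_ideal_sum:
  assumes "left_ideal A" "\<And>i. i \<in> I \<Longrightarrow> f i \<in> A"
  shows "sum f I \<in> A"
  using assms(2)
proof (induction I rule: infinite_finite_induct)
  case (insert i I)
  then show ?case by (simp add: left_ideal_add[OF assms(1)])
qed (simp_all add: left_ideal_zero[OF assms(1)])

lemma left_ideal_image_mult:
  assumes "left_ideal A"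
  shows "left_ideal ((\<lambda>x. x * c) ` A)"
proof (rule left_idealI)
  show "0 \<in> (\<lambda>x. x * c) ` A"
    using left_ideal_zero[OF assms] by force
next
  fix x y assume "x \<in> (\<lambda>x. x * c) ` A" "y \<in> (\<lambda>x. x * c) ` A"
  then show "x + y \<in> (\<lambda>x. x * c) ` A"
    using left_ideal_add[OF assms] by (auto simp flip: distrib_right)
next
  fix r x assume "x \<in> (\<lambda>x. x * c) ` A"
  then show "r * x \<in> (\<lambda>x. x * c) ` A"
    using left_ideal_mult[OF assms] by (auto simp flip: mult.assoc)
qed

lemma left_ideal_colon:
  assumes "left_ideal A" "left_ideal B"
  shows "left_ideal {x \<in> A. x * a \<in> B}"
  using assms by (auto simp: left_ideal_def distrib_right mult.assoc)

lemma left_ideal_UNIV: "left_ideal UNIV"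
  by (simp add: left_ideal_def)

lemma left_ideal_0: "left_ideal {0}"
  by (simp add: left_ideal_def)

lemma nontrivial_left_ideals_below:
  assumes "left_ideal A" "A \<noteq> {0}"
  shows "\<not> trivial_poset {B. left_ideal B \<and> B \<subseteq> A}"
proof
  assume "trivial_poset {B. left_ideal B \<and> B \<subseteq> A}"
  moreover have "{0} \<subseteq> A" using left_ideal_zero[OF assms(1)] by simp
  ultimately have "{0} = A"
    using assms(1) left_ideal_0 unfolding trivial_poset_def by blast
  with assms(2) show False by simp
qed

lemma has_left_Krull_dimension_deviation:
  assumes "has_left_Krull_dimension TYPE('a::ring_1)"
  obtains r :: "('a::ring_1 set \<times> 'a set) rel" and \<alpha>
    where "deviation_eq r \<alpha> {A::'a set. left_ideal A}"
proof -
  have "(1 :: 'a) \<notin> {0}"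
    by simp
  then have "(UNIV :: 'a set) \<noteq> {0}"
    by blast
  then have "\<not> trivial_poset {A::'a set. left_ideal A}"
    using nontrivial_left_ideals_below[OF left_ideal_UNIV] by simp
  then show ?thesis
    using assms that unfolding has_left_Krull_dimension_def has_deviation_def by blast
qed

text \<open>
  Let \<open>J\<close> be the left annihilator of a left ideal \<open>A\<close> with \<open>A\<^sup>2 = 0\<close>.  Both \<open>J\<close> and the right
  annihilator of \<open>J\<close> are two-sided ideals containing \<open>A\<close>, and their intersection has square zero.
  This replaces the usual ideal \<open>A R\<close>, whose elements are sums of products.
\<close>

lemma semiprime_left_ideal_square_nonzero:
  fixes A :: "'a::ring_1 set"
  assumes "semiprime_ring TYPE('a)" "left_ideal A" "A \<noteq> {0}"
  obtains a b where "a \<in> A" "b \<in> A" "a * b \<noteq> 0"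
proof (rule ccontr)
  assume "\<not> thesis"
  with that have sq: "a * b = 0" if "a \<in> A" "b \<in> A" for a b
    using \<open>a \<in> A\<close> \<open>b \<in> A\<close> by blast
  define J where "J = {x. \<forall>a\<in>A. x * a = 0}"
  have J_right: "x * y \<in> J" if "x \<in> J" for x y
    using that left_ideal_mult[OF assms(2)] by (simp add: J_def mult.assoc)
  define I where "I = J \<inter> rann J"
  have "two_sided_ideal I"
    unfolding two_sided_ideal_def
  proof (intro conjI allI ballI left_idealI)
    show "0 \<in> I"
      by (simp add: I_def J_def rann_def)
  next
    fix x y assume "x \<in> I" "y \<in> I"
    then show "x + y \<in> I"
      by (simp add: I_def J_def rann_def distrib_left distrib_right)
  next
    fix r x assume x: "x \<in> I"
    then have "r * x \<in> J"
      by (simp add: I_def J_def mult.assoc)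
    moreover have "s * (r * x) = 0" if "s \<in> J" for s
      using J_right[OF that, of r] x by (simp add: I_def rann_def flip: mult.assoc)
    ultimately show "r * x \<in> I"
      by (simp add: I_def rann_def)
  next
    fix r x assume x: "x \<in> I"
    then have "x * r \<in> J"
      using J_right by (simp add: I_def)
    moreover have "x * r \<in> rann J"
      using x by (simp add: I_def rann_def flip: mult.assoc)
    ultimately show "x * r \<in> I"
      by (simp add: I_def)
  qed
  moreover have "\<forall>x\<in>I. \<forall>y\<in>I. x * y = 0"
    by (simp add: I_def rann_def)
  ultimately have "I = {0}"
    using assms(1) by (simp add: semiprime_ring_def)
  moreover have "A \<subseteq> I"
    using sq by (auto simp: I_def J_def rann_def)
  ultimately show False
    using assms(3) left_ideal_zero[OF assms(2)] by blast
qed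

section \<open>Critical left ideals\<close>

text \<open>
  This is \<open>\<beta>\<close>-criticality in the sense of Krull dimension: \<open>C\<close> and its nonzero left ideals have deviation
  at least \<open>\<beta>\<close>, whereas the quotients \<open>C / D\<close> with \<open>D \<noteq> 0\<close> have deviation less than \<open>\<beta>\<close>.
\<close>

definition critical_left_ideal :: "'o rel \<Rightarrow> 'o \<Rightarrow> 'a::ring_1 set \<Rightarrow> bool" where
  "critical_left_ideal r \<beta> C \<longleftrightarrow> left_ideal C \<and> C \<noteq> {0} \<and>
     (\<forall>D. left_ideal D \<and> D \<noteq> {0} \<and> D \<subseteq> C \<longrightarrow>
        deviation_less r \<beta> {B. left_ideal B \<and> D \<subseteq> B \<and> B \<subseteq> C} \<and>
        \<not> deviation_less r \<beta> {B. left_ideal B \<and> B \<subseteq> D})"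

text \<open>
  A left ideal of minimal deviation \<open>\<beta>\<close> among the nonzero ones in \<open>A\<close> has a critical one
  inside it: otherwise one could keep passing to a nonzero left ideal with a factor of deviation at least
  \<open>\<beta>\<close>, which gives a forbidden descending chain.
\<close>

lemma critical_left_ideal_exists:
  fixes A :: "'a::ring_1 set"
  assumes dev: "deviation_eq r \<alpha> {B::'a set. left_ideal B}"
    and A: "left_ideal A" "A \<noteq> {0}"
  obtains C \<beta> where "critical_left_ideal r \<beta> C" "C \<subseteq> A"
proof -
  let ?below = "\<lambda>D::'a set. {B. left_ideal B \<and> B \<subseteq> D}"
  let ?Q = "\<lambda>D::'a set. left_ideal D \<and> D \<noteq> {0} \<and> D \<subseteq> A"
  define S where "S = {\<beta>. \<exists>D. ?Q D \<and> deviation_eq r \<beta> (?below D)}"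
  have "order_embedding (\<lambda>B. B) (?below A) {B. left_ideal B}"
    by (rule order_embedding_subset) blast
  from deviation_eq_embedding[OF dev this nontrivial_left_ideals_below[OF A]]
  obtain \<beta>0 where "\<beta>0 \<in> S" unfolding S_def using A by blast
  with well_order_wf[OF deviation_eqD(1)[OF dev]]
  have "\<exists>\<beta>\<in>S. \<forall>\<gamma>. (\<gamma>, \<beta>) \<in> r - Id \<longrightarrow> \<gamma> \<notin> S"
    unfolding wf_eq_minimal by blast
  then obtain \<beta> where \<beta>: "\<beta> \<in> S" and min: "\<And>\<gamma>. (\<gamma>, \<beta>) \<in> r - Id \<Longrightarrow> \<gamma> \<notin> S"
    by blast
  from \<beta> obtain M where M: "?Q M" "deviation_eq r \<beta> (?below M)"
    unfolding S_def by blast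
  have not_less: "\<not> deviation_less r \<beta> (?below D)" if D: "?Q D" for D
  proof
    assume "deviation_less r \<beta> (?below D)"
    then obtain \<gamma> where "\<gamma> \<in> underS r \<beta>" "deviation_eq r \<gamma> (?below D)"
      using nontrivial_left_ideals_below[of D] D unfolding deviation_less_def by blast
    then show False
      using min[of \<gamma>] D unfolding S_def underS_def by blast
  qed
  have "\<exists>C. ?Q C \<and> (\<forall>D. ?Q D \<and> D \<subseteq> C \<longrightarrow>
      deviation_less r \<beta> {B. left_ideal B \<and> D \<subseteq> B \<and> B \<subseteq> C})"
  proof (rule ccontr)
    assume none: "\<not> ?thesis"
    have "\<exists>c. \<forall>n. (?Q (c n) \<and> c n \<subseteq> M) \<and> (c (Suc n) \<subseteq> c n \<and>
        \<not> deviation_less r \<beta> {B. left_ideal B \<and> c (Suc n) \<subseteq> B \<and> B \<subseteq> c n})"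
    proof (rule dependent_nat_choice)
      show "\<exists>x. ?Q x \<and> x \<subseteq> M"
        using M by blast
    next
      fix x and n :: nat assume x: "?Q x \<and> x \<subseteq> M"
      with none obtain D where "?Q D" "D \<subseteq> x"
        "\<not> deviation_less r \<beta> {B. left_ideal B \<and> D \<subseteq> B \<and> B \<subseteq> x}"
        by blast
      with x show "\<exists>y. (?Q y \<and> y \<subseteq> M) \<and> (y \<subseteq> x \<and>
          \<not> deviation_less r \<beta> {B. left_ideal B \<and> y \<subseteq> B \<and> B \<subseteq> x})"
        by (intro exI[of _ D]) auto
    qed
    then obtain c where chain: "\<forall>n. (?Q (c n) \<and> c n \<subseteq> M) \<and> (c (Suc n) \<subseteq> c n \<and>
        \<not> deviation_less r \<beta> {B. left_ideal B \<and> c (Suc n) \<subseteq> B \<and> B \<subseteq> c n})"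
      by (rule exE)
    have c: "?Q (c n)" "c n \<subseteq> M" "c (Suc n) \<subseteq> c n"
      "\<not> deviation_less r \<beta> {B. left_ideal B \<and> c (Suc n) \<subseteq> B \<and> B \<subseteq> c n}" for n
      using spec[OF chain, of n] by simp_all
    have "antimono c"
      unfolding antimono_iff_le_Suc using c(3) by blast
    moreover have "range c \<subseteq> ?below M"
      using c(1,2) by blast
    ultimately have "finite {i. \<not> deviation_less r \<beta> (?below M \<inter> {c (Suc i)..c i})}"
      using deviation_eqD(5)[OF M(2)] by blast
    moreover have "?below M \<inter> {c (Suc i)..c i} = {B. left_ideal B \<and> c (Suc i) \<subseteq> B \<and> B \<subseteq> c i}" for i
      using c(2)[of i] by auto
    ultimately show False
      using c(4) by simp
  qed
  then obtain C where C: "?Q C" "\<forall>D. ?Q D \<and> D \<subseteq> C \<longrightarrow>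
      deviation_less r \<beta> {B. left_ideal B \<and> D \<subseteq> B \<and> B \<subseteq> C}"
    by (elim exE conjE) (rule that; blast)
  show thesis
  proof (rule that)
    show "C \<subseteq> A"
      using C(1) by simp
    show "critical_left_ideal r \<beta> C"
      unfolding critical_left_ideal_def
    proof (intro conjI allI impI)
      show "left_ideal C" "C \<noteq> {0}"
        using C(1) by simp_all
    next
      fix D assume D: "left_ideal D \<and> D \<noteq> {0} \<and> D \<subseteq> C"
      with C(1) have Q: "?Q D" by auto
      with D show "deviation_less r \<beta> {B. left_ideal B \<and> D \<subseteq> B \<and> B \<subseteq> C}"
        using spec[OF C(2), of D] by simp
      show "\<not> deviation_less r \<beta> (?below D)"
        by (rule not_less[OF Q])
    qed
  qed
qed

text \<open>
  In a critical left ideal \<open>C\<close> take \<open>a\<close> with \<open>C a \<noteq> 0\<close>.  If \<open>N = {x \<in> C. x a = 0}\<close> were nonzero, then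
  \<open>C a \<cong> C / N\<close> would have smaller deviation than \<open>C\<close>, although it is a nonzero left ideal inside \<open>C\<close>.
\<close>

lemma left_ideal_contains_self_cancellable:
  fixes A :: "'a::ring_1 set"
  assumes semiprime: "semiprime_ring TYPE('a)"
    and dev: "deviation_eq r \<alpha> {B::'a set. left_ideal B}"
    and A: "left_ideal A" "A \<noteq> {0}"
  obtains a where "a \<in> A" "a \<noteq> 0" "\<And>x. x * a * a = 0 \<Longrightarrow> x * a = 0"
proof -
  obtain C \<beta> where critical: "critical_left_ideal r \<beta> C" and CA: "C \<subseteq> A"
    by (rule critical_left_ideal_exists[OF dev A])
  then have C: "left_ideal C" "C \<noteq> {0}"
    unfolding critical_left_ideal_def by simp_all
  have quotient: "deviation_less r \<beta> {B. left_ideal B \<and> D \<subseteq> B \<and> B \<subseteq> C}"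
    and sub: "\<not> deviation_less r \<beta> {B. left_ideal B \<and> B \<subseteq> D}"
    if "left_ideal D" "D \<noteq> {0}" "D \<subseteq> C" for D
    using critical that unfolding critical_left_ideal_def by simp_all
  obtain b a where ba: "b \<in> C" "a \<in> C" "b * a \<noteq> 0"
    using semiprime_left_ideal_square_nonzero[OF semiprime C(1,2)] by blast
  define N where "N = {x \<in> C. x * a \<in> {0}}"
  define Ca where "Ca = (\<lambda>x. x * a) ` C"
  have N: "left_ideal N" "N \<subseteq> C"
    unfolding N_def using left_ideal_colon[OF C(1) left_ideal_0] by auto
  have Ca: "left_ideal Ca" "Ca \<subseteq> C" "Ca \<noteq> {0}"
    unfolding Ca_def using left_ideal_image_mult[OF C(1)] left_ideal_mult[OF C(1) ba(2)] ba
    by auto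
  have "order_embedding (\<lambda>B. {x \<in> C. x * a \<in> B}) {B. left_ideal B \<and> B \<subseteq> Ca}
      {B. left_ideal B \<and> N \<subseteq> B \<and> B \<subseteq> C}"
  proof (rule order_embeddingI)
    fix B assume "B \<in> {B. left_ideal B \<and> B \<subseteq> Ca}"
    then show "{x \<in> C. x * a \<in> B} \<in> {B. left_ideal B \<and> N \<subseteq> B \<and> B \<subseteq> C}"
      using left_ideal_colon[OF C(1)] left_ideal_zero by (auto simp: N_def)
  next
    fix B B' assume "B \<in> {B. left_ideal B \<and> B \<subseteq> Ca}"
      "{x \<in> C. x * a \<in> B} \<subseteq> {x \<in> C. x * a \<in> B'}"
    then show "B \<subseteq> B'"
      unfolding Ca_def by blast
  qed auto
  note deviation_less_embedding[OF _ this]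
  then have "N = {0}"
    using quotient[OF N(1) _ N(2)] sub[OF Ca(1,3,2)] by metis
  moreover have "x * a \<in> C" for x
    using left_ideal_mult[OF C(1) ba(2)] .
  ultimately have "x * a = 0" if "x * a * a = 0" for x
    using that unfolding N_def by blast
  moreover have "a \<noteq> 0" using ba(3) by auto
  ultimately show thesis
    using that[of a] ba(2) CA by blast
qed

section \<open>Essential left ideals contain left cancellable elements\<close>

text \<open>
  The equations \<open>a\<^sub>j a\<^sub>i = 0\<close> for \<open>i < j\<close> are triangular: multiplying \<open>\<Sum> s\<^sub>i a\<^sub>i = 0\<close> by \<open>a\<^sub>k\<close>
  on the right kills the terms after \<open>k\<close>, and the terms before \<open>k\<close> vanish by induction.
\<close>

lemma triangular_independent:
  fixes a s :: "nat \<Rightarrow> 'a::ring_1"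
  assumes triangular: "\<And>i j. i < j \<Longrightarrow> j < n \<Longrightarrow> a j * a i = 0"
    and cancel: "\<And>i x. i < n \<Longrightarrow> x * a i * a i = 0 \<Longrightarrow> x * a i = 0"
    and sum: "(\<Sum>i<n. s i * a i) = 0"
    and "k < n"
  shows "s k * a k = 0"
  using \<open>k < n\<close>
proof (induction k rule: less_induct)
  case (less k)
  have "s i * a i * a k = 0" if "i < n" "i \<noteq> k" for i
  proof (cases "i < k")
    case True
    then show ?thesis using less.IH that(1) by simp
  next
    case False
    then have "a i * a k = 0" using that triangular by simp
    then show ?thesis by (simp add: mult.assoc)
  qed
  then have "(\<Sum>i<n. s i * a i * a k) = (\<Sum>i\<in>{k}. s i * a i * a k)"
    by (intro sum.mono_neutral_right) (use less.prems in auto)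
  moreover have "(\<Sum>i<n. s i * a i * a k) = (\<Sum>i<n. s i * a i) * a k"
    by (simp add: sum_distrib_right)
  ultimately have "s k * a k * a k = 0"
    by (simp add: sum)
  then show ?case
    using cancel less.prems by blast
qed

text \<open>
  In an infinite direct sum of left ideals \<open>R a\<^sub>i\<close>, sending \<open>S\<close> to the partial sum over \<open>i \<in> S\<close> is an
  embedding of the power set of the natural numbers.
\<close>

lemma no_infinite_triangular_sequence:
  fixes a :: "nat \<Rightarrow> 'a::ring_1"
  assumes dev: "deviation_eq r \<alpha> {B::'a set. left_ideal B}"
    and triangular: "\<And>i j. i < j \<Longrightarrow> a j * a i = 0"
    and cancel: "\<And>i x. x * a i * a i = 0 \<Longrightarrow> x * a i = 0"
    and nonzero: "\<And>i. a i \<noteq> 0"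
  shows False
proof -
  define span where "span S = {x. \<exists>n s. (\<forall>i. i \<notin> S \<or> n \<le> i \<longrightarrow> s i = 0) \<and> x = (\<Sum>i<n. s i * a i)}"
    for S
  (* The coefficients vanish beyond n, so that two sums can be extended to a common length. *)
  have extend: "(\<Sum>i<n. s i * a i) = (\<Sum>i<m. s i * a i)"
    if "\<And>i. n \<le> i \<Longrightarrow> s i = 0" "n \<le> m" for n m :: nat and s
    by (rule sum.mono_neutral_left) (use that in auto)
  have "order_embedding span UNIV {B. left_ideal B}"
  proof (rule order_embeddingI)
    fix S
    have "left_ideal (span S)"
    proof (rule left_idealI)
      show "0 \<in> span S"
        unfolding span_def by (intro CollectI exI[of _ "0::nat"] exI[of _ "\<lambda>_. 0"]) simp
    next
      fix x y assume "x \<in> span S" "y \<in> span S"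
      then obtain n s m t where
        s: "\<forall>i. i \<notin> S \<or> n \<le> i \<longrightarrow> s i = 0" "x = (\<Sum>i<n. s i * a i)" and
        t: "\<forall>i. i \<notin> S \<or> m \<le> i \<longrightarrow> t i = 0" "y = (\<Sum>i<m. t i * a i)"
        unfolding span_def by blast
      have "x = (\<Sum>i<max n m. s i * a i)" "y = (\<Sum>i<max n m. t i * a i)"
        unfolding s(2) t(2) using s(1) t(1) by (intro extend; simp)+
      then have "x + y = (\<Sum>i<max n m. (s i + t i) * a i)"
        by (simp add: distrib_right sum.distrib)
      moreover have "\<forall>i. i \<notin> S \<or> max n m \<le> i \<longrightarrow> s i + t i = 0"
        using s(1) t(1) by simp
      ultimately show "x + y \<in> span S"
        unfolding span_def by (intro CollectI exI[of _ "max n m"] exI[of _ "\<lambda>i. s i + t i"]) simp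
    next
      fix q x assume "x \<in> span S"
      then obtain n s where
        s: "\<forall>i. i \<notin> S \<or> n \<le> i \<longrightarrow> s i = 0" "x = (\<Sum>i<n. s i * a i)"
        unfolding span_def by blast
      then have "q * x = (\<Sum>i<n. (q * s i) * a i)"
        by (simp add: sum_distrib_left mult.assoc)
      then show "q * x \<in> span S"
        unfolding span_def using s(1)
        by (intro CollectI exI[of _ n] exI[of _ "\<lambda>i. q * s i"]) simp
    qed
    then show "span S \<in> {B. left_ideal B}" by simp
  next
    fix S T :: "nat set" assume "S \<subseteq> T"
    then show "span S \<subseteq> span T"
      unfolding span_def by blast
  next
    fix S T assume le: "span S \<subseteq> span T"
    show "S \<subseteq> T"
    proof
      fix j assume "j \<in> S"
      have "a j = (\<Sum>i<Suc j. of_bool (i = j) * a i)"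
        by simp
      with \<open>j \<in> S\<close> have "a j \<in> span S"
        unfolding span_def
        by (intro CollectI exI[of _ "Suc j"] exI[of _ "\<lambda>i. of_bool (i = j)"]) auto
      with le have "a j \<in> span T" by blast
      then obtain n s where
        s: "\<forall>i. i \<notin> T \<or> n \<le> i \<longrightarrow> s i = 0" "a j = (\<Sum>i<n. s i * a i)"
        unfolding span_def by blast
      let ?m = "max n (Suc j)"
      show "j \<in> T"
      proof (rule ccontr)
        assume "j \<notin> T"
        have "a j = (\<Sum>i<?m. s i * a i)"
          unfolding s(2) using s(1) by (intro extend) auto
        moreover have "(\<Sum>i<?m. of_bool (i = j) * a i) = (\<Sum>i\<in>{j}. of_bool (i = j) * a i)"
          by (rule sum.mono_neutral_right) auto
        ultimately have "(\<Sum>i<?m. (s i - of_bool (i = j)) * a i) = 0"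
          by (simp add: left_diff_distrib sum_subtractf)
        from triangular_independent[OF triangular cancel this, of j]
        have "(s j - 1) * a j = 0" by simp
        with s(1) \<open>j \<notin> T\<close> nonzero[of j] show False by simp
      qed
    qed
  qed
  with power_set_nat_not_embedded_in_deviation[OF dev] show False by blast
qed

text \<open>
  As long as no element with zero left annihilator has been found, the common left annihilator \<open>N\<close> of the
  elements chosen so far is nonzero, as it equals the left annihilator of their sum.  By essentiality
  \<open>N\<close> meets \<open>E\<close>, and the next element can be taken from the intersection.
\<close>

lemma essential_contains_left_cancellable:
  fixes E :: "'a::ring_1 set"
  assumes semiprime: "semiprime_ring TYPE('a)"
    and dev: "deviation_eq r \<alpha> {B::'a set. left_ideal B}"
    and E: "essential_left_ideal E"
  obtains c where "c \<in> E" "\<And>x. x * c = 0 \<Longrightarrow> x = 0"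
proof (rule ccontr)
  assume "\<not> thesis"
  with that have none: "\<exists>x. x * c = 0 \<and> x \<noteq> 0" if "c \<in> E" for c
    using \<open>c \<in> E\<close> by blast
  have idealE: "left_ideal E"
    using E by (simp add: essential_left_ideal_def)
  let ?P = "\<lambda>(a :: nat \<Rightarrow> 'a) n b.
    b \<in> E \<and> b \<noteq> 0 \<and> (\<forall>i<n. b * a i = 0) \<and> (\<forall>x. x * b * b = 0 \<longrightarrow> x * b = 0)"
  have "\<exists>a. \<forall>n. ?P a n (a n)"
  proof (rule dependent_wellorder_choice)
    fix b and f g :: "nat \<Rightarrow> 'a" and n assume "\<And>i. i < n \<Longrightarrow> f i = g i"
    then show "?P f n b = ?P g n b" by simp
  next
    fix n and a :: "nat \<Rightarrow> 'a" assume prev: "\<And>i. i < n \<Longrightarrow> ?P a i (a i)"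
    define N where "N = {x. \<forall>i<n. x * a i = 0}"
    have N: "left_ideal N"
      by (rule left_idealI) (auto simp: N_def distrib_right mult.assoc)
    have "(\<Sum>i<n. a i) \<in> E"
      by (rule left_ideal_sum[OF idealE]) (use prev in auto)
    from none[OF this] obtain x where x: "x * (\<Sum>i<n. a i) = 0" "x \<noteq> 0"
      by blast
    have "x * a k = 0" if "k < n" for k
    proof (rule triangular_independent[where n = n and s = "\<lambda>_. x"])
      show "(\<Sum>i<n. x * a i) = 0"
        using x(1) by (simp add: sum_distrib_left)
    qed (use prev that in auto)
    with x(2) have "N \<noteq> {0}"
      by (auto simp: N_def)
    with E N have "E \<inter> N \<noteq> {0}"
      by (simp add: essential_left_ideal_def)
    moreover have "left_ideal (E \<inter> N)"
      using idealE N by (simp add: left_ideal_def)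
    ultimately obtain b where "b \<in> E \<inter> N" "b \<noteq> 0" "\<And>x. x * b * b = 0 \<Longrightarrow> x * b = 0"
      using left_ideal_contains_self_cancellable[OF semiprime dev] by metis
    then show "\<exists>b. ?P a n b"
      unfolding N_def by blast
  qed
  then obtain a where a: "\<forall>n. ?P a n (a n)"
    by (rule exE)
  show False
    by (rule no_infinite_triangular_sequence[OF dev, of a]) (use a in simp_all)
qed

section \<open>The kernel of an endomorphism with large image\<close>

lemma ring_endomorphism_zero: "ring_endomorphism \<sigma> \<Longrightarrow> \<sigma> 0 = 0"
  unfolding ring_endomorphism_def by (metis add_cancel_left_left)

lemma left_ideal_vimage:
  assumes "ring_endomorphism \<sigma>" "left_ideal A"
  shows "left_ideal (\<sigma> -` A)"
  using assms ring_endomorphism_zero[OF assms(1)]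
  by (auto simp: left_ideal_def ring_endomorphism_def)

lemma two_sided_ideal_ring_kernel:
  assumes "ring_endomorphism \<sigma>"
  shows "two_sided_ideal (ring_kernel \<sigma>)"
  using assms ring_endomorphism_zero[OF assms]
  by (auto simp: two_sided_ideal_def left_ideal_def ring_kernel_def ring_endomorphism_def)

lemma inj_if_ring_kernel_trivial:
  assumes "ring_endomorphism \<sigma>" "ring_kernel \<sigma> = {0}"
  shows "inj \<sigma>"
proof (rule injI)
  fix x y assume "\<sigma> x = \<sigma> y"
  moreover have "\<sigma> (x - y) + \<sigma> y = \<sigma> x"
    using assms(1) unfolding ring_endomorphism_def by (metis diff_add_cancel)
  ultimately have "x - y \<in> ring_kernel \<sigma>"
    by (simp add: ring_kernel_def)
  then show "x = y" using assms(2) by simp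
qed

text \<open>
  If a left ideal \<open>A\<close> meets the two-sided ideal \<open>I\<close> in zero, then \<open>I A \<subseteq> I \<inter> A = 0\<close>, so \<open>A\<close> lies in the
  right annihilator of \<open>I\<close>, a two-sided ideal that is zero by primeness.
\<close>

lemma prime_two_sided_ideal_essential:
  fixes I :: "'a::ring_1 set"
  assumes prime: "prime_ring TYPE('a)"
    and I: "two_sided_ideal I" "I \<noteq> {0}"
  shows "essential_left_ideal I"
  unfolding essential_left_ideal_def
proof (intro conjI allI impI)
  show ideal: "left_ideal I"
    using I(1) by (simp add: two_sided_ideal_def)
  fix A :: "'a set" assume A: "left_ideal A \<and> A \<noteq> {0}"
  show "I \<inter> A \<noteq> {0}"
  proof
    assume zero: "I \<inter> A = {0}"
    have right: "s * q \<in> I" if "s \<in> I" for s q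
      using I(1) that by (simp add: two_sided_ideal_def)
    have "two_sided_ideal (rann I)"
      unfolding two_sided_ideal_def
    proof (intro conjI allI ballI left_idealI)
      fix q x assume "x \<in> rann I"
      then show "q * x \<in> rann I" "x * q \<in> rann I"
        using right by (auto simp: rann_def simp flip: mult.assoc)
    qed (auto simp: rann_def distrib_left)
    moreover have "\<forall>s\<in>I. \<forall>x\<in>rann I. s * x = 0"
      by (simp add: rann_def)
    ultimately have "rann I = {0}"
      using prime I unfolding prime_ring_def by blast
    moreover have "s * x = 0" if "s \<in> I" "x \<in> A" for s x
      using right[OF that(1), of x] left_ideal_mult[of A x s] A that(2) zero by blast
    then have "A \<subseteq> rann I"
      by (auto simp: rann_def)
    ultimately show False
      using A left_ideal_zero by blast
  qed
qed

lemma large_image_kernel_not_essential: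
  fixes \<sigma> :: "'a::ring_1 \<Rightarrow> 'a"
  assumes semiprime: "semiprime_ring TYPE('a)"
    and \<sigma>: "ring_endomorphism \<sigma>"
    and large: "large_image \<sigma>"
    and Krull: "has_left_Krull_dimension TYPE('a)"
  shows "\<not> essential_left_ideal (ring_kernel \<sigma>)"
proof
  assume ess: "essential_left_ideal (ring_kernel \<sigma>)"
  obtain r :: "('a set \<times> 'a set) rel" and \<alpha> where dev: "deviation_eq r \<alpha> {A::'a set. left_ideal A}"
    using has_left_Krull_dimension_deviation[OF Krull] .
  obtain c where c: "\<sigma> c = 0" "\<And>x. x * c = 0 \<Longrightarrow> x = 0"
    using essential_contains_left_cancellable[OF semiprime dev ess]
    unfolding ring_kernel_def by blast
  obtain L where L: "essential_left_ideal L" "L \<subseteq> range \<sigma>"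
    using large unfolding large_image_def by blast
  obtain d where d: "d \<in> L" "\<And>x. x * d = 0 \<Longrightarrow> x = 0"
    using essential_contains_left_cancellable[OF semiprime dev L(1)] by blast
  have d_inj: "x = y" if "x * d = y * d" for x y
    using d(2)[of "x - y"] that by (simp add: left_diff_distrib)
  have power_cancel: "x * c ^ n = 0 \<Longrightarrow> x = 0" for x n
  proof (induction n arbitrary: x)
    case (Suc n)
    have "(x * c) * c ^ n = 0"
      using Suc.prems by (simp add: mult.assoc)
    from Suc.IH[OF this] show ?case
      by (rule c(2))
  qed simp
  have c_inj: "x = y" if "x * c ^ n = y * c ^ n" for x y n
    using power_cancel[of "x - y" n] that by (simp add: left_diff_distrib)
  have \<sigma>_mult: "\<sigma> (x * y) = \<sigma> x * \<sigma> y" for x y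
    using \<sigma> by (simp add: ring_endomorphism_def)
  let ?P = "{A::'a set. left_ideal A}"
  let ?b = "\<lambda>n. (\<lambda>x. x * c ^ n) ` UNIV"
  (* The factors of the chain R c^n are copies of R / R c, and c lies in the kernel, so that each of
     them contains a copy of the interval above the kernel. *)
  let ?pull = "\<lambda>A. \<sigma> -` ((\<lambda>x. x * d) ` A)"
  let ?g = "\<lambda>n A. (\<lambda>x. x * c ^ n) ` ?pull A"
  have "\<not> order_embedding (\<lambda>A. A) ?P ?P"
  proof (rule self_similar_not_embedded_in_deviation[OF _ _ _ _ dev])
    show "range ?b \<subseteq> ?P"
      using left_ideal_image_mult[OF left_ideal_UNIV] by auto
    have "x * c ^ Suc n = (x * c) * c ^ n" for x n
      by (simp add: mult.assoc)
    then show "antimono ?b"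
      unfolding antimono_iff_le_Suc by blast
    show "order_embedding (?g n) ?P (?P \<inter> {?b (Suc n)..?b n})" for n
    proof (rule order_embeddingI)
      fix A :: "'a set" assume "A \<in> ?P"
      then have A: "left_ideal A" by simp
      have "left_ideal (?g n A)"
        by (intro left_ideal_image_mult left_ideal_vimage[OF \<sigma>] A)
      moreover have "x * c ^ Suc n \<in> ?g n A" for x
      proof -
        have "x * c \<in> ?pull A"
          using left_ideal_zero[OF left_ideal_image_mult[OF A, of d]] c(1) by (simp add: \<sigma>_mult)
        moreover have "x * c ^ Suc n = (x * c) * c ^ n"
          by (simp add: mult.assoc)
        ultimately show ?thesis by blast
      qed
      ultimately show "?g n A \<in> ?P \<inter> {?b (Suc n)..?b n}"
        by auto
    next
      fix A B :: "'a set" assume "A \<subseteq> B"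
      then show "?g n A \<subseteq> ?g n B" by blast
    next
      fix A B :: "'a set" assume le: "?g n A \<subseteq> ?g n B"
      show "A \<subseteq> B"
      proof
        fix x assume "x \<in> A"
        have "x * d \<in> L"
          using L(1) d(1) by (simp add: essential_left_ideal_def left_ideal_mult)
        with L(2) obtain y where y: "x * d = \<sigma> y" by blast
        with \<open>x \<in> A\<close> have "y \<in> ?pull A" by (auto simp flip: y)
        with le have "y * c ^ n \<in> ?g n B" by blast
        then obtain z where "z \<in> ?pull B" "y * c ^ n = z * c ^ n" by blast
        with c_inj have "y \<in> ?pull B" by blast
        with y obtain x' where "x' \<in> B" "x * d = x' * d" by auto
        with d_inj show "x \<in> B" by blast
      qed
    qed
    show "\<not> trivial_poset ?P"
      by (rule deviation_eqD(3)[OF dev])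
  qed
  then show False
    using order_embedding_subset[of ?P ?P] by blast
qed

theorem theorem1p10:
  fixes \<sigma> :: "'a::ring_1 \<Rightarrow> 'a"
  assumes "semiprime_ring TYPE('a)"
    and "ring_endomorphism \<sigma>"
    and "large_image \<sigma>"
    and "has_left_Krull_dimension TYPE('a)"
  shows "\<not> essential_left_ideal (ring_kernel \<sigma>) \<and> (prime_ring TYPE('a) \<longrightarrow> inj \<sigma>)"
proof (intro conjI impI)
  show not_ess: "\<not> essential_left_ideal (ring_kernel \<sigma>)"
    by (rule large_image_kernel_not_essential[OF assms])
  assume "prime_ring TYPE('a)"
  from prime_two_sided_ideal_essential[OF this two_sided_ideal_ring_kernel[OF assms(2)]] not_ess
  have "ring_kernel \<sigma> = {0}" by argo
  then show "inj \<sigma>"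
    by (rule inj_if_ring_kernel_trivial[OF assms(2)])
qed

end
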